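(* Suppose that $n\ge 1$ is an integer. If $m=(K+1)^iK^{n-i}$ with integers $K\ge 1$ and $i\in[0,n-1]$, then every minimiser $A\subset\mathbb{R}^n$ of size $|A|=m$ is a Cartesian product of $i$ real sets of size $K+1$ and $n-i$ real sets of size $K$; that is, $A=S_1\times\dotsb\times S_n$ with $S_1,\ldots,S_n\subset\mathbb{R}$, where exactly $i$ of the sets $S_j$ (not necessarily the first $i$) have size $K+1$ and the remaining $n-i$ have size $K$.
   Context: $[a,b]$ denotes the set of integers from $a$ to $b$. For $i\in[1,n]$, $\pi_i$ is the orthogonal projection of $\mathbb{R}^n$ onto the coordinate hyperplane $\{(x_1,\ldots,x_n)\in\mathbb{R}^n : x_i=0\}$. For a finite set $A\subset\mathbb{R}^n$ let $\sigma_n(A):=\sum_{i=1}^n|\pi_i(A)|$. A finite set $A\subset\mathbb{R}^n$ is called a minimiser if $\sigma_n(A)$ is smallest possible among all sets in $\mathbb{R}^n$ of size $|A|$; that is, $\sigma_n(A)\le\sigma_n(B)$ for every $B\subset\mathbb{R}^n$ with $|B|=|A|$. *)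

theory Defs
  imports "HOL-Analysis.Analysis"
begin

definition coord_proj :: "'n \<Rightarrow> real ^ 'n \<Rightarrow> real ^ 'n" where
  "coord_proj i x = (\<chi> j. if j = i then 0 else x $ j)"

text \<open>These two facts characterise the orthogonal projection onto the coordinate
  hyperplane of all \<open>y\<close> with \<open>y $ i = 0\<close>.\<close>

lemma coord_proj_in_hyperplane: "coord_proj i x \<in> {y. y $ i = 0}"
  by (simp add: coord_proj_def)

lemma orthogonal_coord_proj:
  fixes x y :: "real ^ 'n"
  assumes "y \<in> {y. y $ i = 0}"
  shows "orthogonal (x - coord_proj i x) y"
  using assms by (auto simp: orthogonal_def inner_vec_def coord_proj_def intro!: sum.neutral)

definition proj_sum :: "(real ^ 'n) set \<Rightarrow> nat" where
  "proj_sum A = (\<Sum>i\<in>UNIV. card (coord_proj i ` A))"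

text \<open>Finiteness of \<open>B\<close> is required explicitly because \<open>card\<close> is \<open>0\<close> on infinite sets.\<close>

definition minimiser :: "(real ^ 'n) set \<Rightarrow> bool" where
  "minimiser A \<longleftrightarrow>
     finite A \<and> (\<forall>B :: (real ^ 'n) set. finite B \<and> card B = card A \<longrightarrow> proj_sum A \<le> proj_sum B)"

definition cart_prod :: "('n \<Rightarrow> real set) \<Rightarrow> (real ^ 'n) set" where
  "cart_prod S = {x. \<forall>j. x $ j \<in> S j}"

end

theory Submission
  imports Defs
begin

text \<open>
  Write \<open>m = card A\<close> and let \<open>s\<^sub>j(a)\<close> be the number of points of \<open>A\<close> on the line through
  \<open>a \<in> A\<close> in direction \<open>j\<close> (\<open>line_size A j a\<close> below). A line with \<open>s\<close> points of \<open>A\<close> is one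
  point of the projection, so each of its points may be charged \<open>1 / s\<close>: the quantity to
  minimise is the sum of all \<open>1 / s\<^sub>j(a)\<close>. Two facts limit how small it can be.

  \<^item> The sum of all \<open>ln s\<^sub>j(a)\<close> is at most \<open>m ln m\<close>. This is the entropy form of the
    Loomis--Whitney inequality: for \<open>X\<close> uniform on \<open>A\<close>, the mean of \<open>ln s\<^sub>j\<close> is the conditional
    entropy of \<open>X\<^sub>j\<close> given all other coordinates, and by the chain rule these conditional
    entropies add up to at most \<open>H(X) = ln m\<close>. Equality forces every \<open>X\<^sub>j\<close> to be independent
    of the other coordinates, so \<open>A\<close> is closed under exchanging a single coordinate between
    two of its points, and hence is a product (\<open>entropy_inequality\<close>,
    \<open>entropy_equality_exchange\<close>, \<open>cart_prod_if_exchange\<close>).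

  \<^item> As a function of \<open>ln s\<close> the value \<open>1 / s\<close> is strictly convex. Because \<open>s\<close> is an integer,
    it lies on or above the chord through \<open>K\<close> and \<open>K + 1\<close>, with equality only at these two
    values (\<open>tilted_inverse_gt\<close>).

  Replacing \<open>1 / s\<close> by the chord turns the first fact into a lower bound for the sum of
  projections. A box with side sizes \<open>K\<close> and \<open>K + 1\<close> and with \<open>m\<close> points attains this
  bound, so a minimiser attains it as well. Thus both facts hold with equality for a minimiser:
  it is a product, and all its sides have size \<open>K\<close> or \<open>K + 1\<close>. How many sides are of each
  kind can be read off from \<open>m\<close>, since \<open>(K + 1) ^ p * K ^ (n - p)\<close> is strictly increasing in \<open>p\<close>.
\<close>

section \<open>Fibres\<close>

definition fibre :: "(real ^ 'n) set \<Rightarrow> 'n set \<Rightarrow> real ^ 'n \<Rightarrow> (real ^ 'n) set" where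
  "fibre A J a = {b \<in> A. \<forall>k\<in>J. b $ k = a $ k}"

abbreviation line_size :: "(real ^ 'n) set \<Rightarrow> 'n \<Rightarrow> real ^ 'n \<Rightarrow> nat" where
  "line_size A j a \<equiv> card (fibre A (- {j}) a)"

lemma fibre_subset: "fibre A J a \<subseteq> A"
  by (auto simp: fibre_def)

lemma finite_fibre [simp]: "finite A \<Longrightarrow> finite (fibre A J a)"
  by (rule finite_subset [OF fibre_subset])

lemma card_fibre_pos: "finite A \<Longrightarrow> a \<in> A \<Longrightarrow> card (fibre A J a) > 0"
  by (subst card_gt_0_iff) (auto simp: fibre_def)

lemma fibre_empty [simp]: "fibre A {} a = A"
  by (auto simp: fibre_def)

lemma fibre_UNIV: "a \<in> A \<Longrightarrow> fibre A UNIV a = {a}"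
  by (auto simp: fibre_def vec_eq_iff)

text \<open>Each fibre of \<open>f\<close> in \<open>A\<close> contributes a total weight of \<open>1\<close>.\<close>

lemma sum_inverse_card_vimage:
  assumes "finite A"
  shows "(\<Sum>a\<in>A. 1 / real (card {b \<in> A. f b = f a})) = card (f ` A)"
proof -
  have "(\<Sum>a\<in>A. 1 / real (card {b \<in> A. f b = f a}))
      = (\<Sum>y\<in>f ` A. \<Sum>a | a \<in> A \<and> f a = y. 1 / real (card {b \<in> A. f b = f a}))"
    using assms by (rule sum.image_gen)
  also have "\<dots> = (\<Sum>y\<in>f ` A. 1)"
  proof (rule sum.cong [OF refl])
    fix y assume "y \<in> f ` A"
    then have "{a \<in> A. f a = y} \<noteq> {}" by auto
    then have "card {a \<in> A. f a = y} > 0"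
      using assms by (simp add: card_gt_0_iff)
    moreover have "(\<Sum>a | a \<in> A \<and> f a = y. 1 / real (card {b \<in> A. f b = f a}))
        = (\<Sum>a | a \<in> A \<and> f a = y. 1 / real (card {b \<in> A. f b = y}))"
      by (rule sum.cong) auto
    ultimately show "(\<Sum>a | a \<in> A \<and> f a = y. 1 / real (card {b \<in> A. f b = f a})) = 1"
      by simp
  qed
  finally show ?thesis by simp
qed

lemma card_coord_proj:
  assumes "finite A"
  shows "real (card (coord_proj j ` A)) = (\<Sum>a\<in>A. 1 / line_size A j a)"
proof -
  have "fibre A (- {j}) a = {b \<in> A. coord_proj j b = coord_proj j a}" for a
    by (auto simp: fibre_def coord_proj_def vec_eq_iff)
  then show ?thesis
    using sum_inverse_card_vimage [OF assms, of "coord_proj j"] by simp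
qed

lemma proj_sum_eq:
  assumes "finite A"
  shows "real (proj_sum A) = (\<Sum>j\<in>UNIV. \<Sum>a\<in>A. 1 / line_size A j a)"
  by (simp add: proj_sum_def card_coord_proj [OF assms])

section \<open>The entropy inequality\<close>

text \<open>
  A triple \<open>(a, b, c)\<close> records that \<open>a\<close> is spliced from \<open>b\<close> and \<open>c\<close>: it takes coordinate \<open>j\<close>
  from \<open>b\<close> and all others from \<open>c\<close>. Hence \<open>b\<close> and \<open>c\<close> determine \<open>a\<close>. The further requirement that
  \<open>b\<close> agrees with \<open>a\<close> on \<open>J\<close> puts \<open>b\<close> and \<open>c\<close> into the same \<open>J\<close>-fibre when \<open>j \<notin> J\<close>.
\<close>

definition splices :: "(real ^ 'n) set \<Rightarrow> 'n set \<Rightarrow> 'n \<Rightarrow> ((real ^ 'n) \<times> (real ^ 'n) \<times> (real ^ 'n)) set" where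
  "splices A J j = (SIGMA a:A. fibre A (insert j J) a \<times> fibre A (- {j}) a)"

lemma inj_on_splices:
  fixes A :: "(real ^ 'n) set"
  shows "inj_on (\<lambda>(a, b, c). (c, b)) (splices A J j)"
proof (rule inj_onI)
  fix x y assume x: "x \<in> splices A J j" and y: "y \<in> splices A J j"
    and eq: "(\<lambda>(a, b, c). (c, b)) x = (\<lambda>(a, b, c). (c, b)) y"
  obtain a b c where abc: "x = (a, b, c)" by (cases x)
  with eq obtain a' where a': "y = (a', b, c)" by (cases y) auto
  have "a $ k = a' $ k" for k
    using x y unfolding abc a' by (cases "k = j") (auto simp: splices_def fibre_def)
  then show "x = y"
    by (simp add: abc a' vec_eq_iff)
qed

lemma splices_image:
  assumes "j \<notin> J"
  shows "(\<lambda>(a, b, c). (c, b)) ` splices A J j \<subseteq> (SIGMA c:A. fibre A J c)"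
  using assms by (force simp: splices_def fibre_def)

text \<open>
  The product in the numerator counts the splices with result \<open>a\<close>. As a splice is determined by
  the pair \<open>(c, b)\<close>, which lies in one \<open>J\<close>-fibre, a fibre with \<open>N\<close> points admits at most
  \<open>N * N\<close> of them. Dividing by \<open>N\<close> leaves at most \<open>N\<close> for each fibre, and the fibres
  partition \<open>A\<close>.
\<close>

lemma sum_fibre_ratio_le:
  assumes "finite A" "j \<notin> J"
  shows "(\<Sum>a\<in>A. real (card (fibre A (insert j J) a)) * line_size A j a / card (fibre A J a))
    \<le> card A"
proof -
  have "(\<Sum>a\<in>A. real (card (fibre A (insert j J) a)) * line_size A j a / card (fibre A J a))
      = (\<Sum>a\<in>A. \<Sum>(b, c)\<in>fibre A (insert j J) a \<times> fibre A (- {j}) a. 1 / card (fibre A J c))"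
  proof (rule sum.cong [OF refl])
    fix a assume "a \<in> A"
    \<comment> \<open>The weight may be read off at \<open>c\<close> instead of \<open>a\<close>, so that it survives forgetting \<open>a\<close>.\<close>
    have "fibre A J c = fibre A J a" if "c \<in> fibre A (- {j}) a" for c
      using that assms(2) by (force simp: fibre_def)
    then have "(\<Sum>(b, c)\<in>fibre A (insert j J) a \<times> fibre A (- {j}) a. 1 / real (card (fibre A J c)))
       = (\<Sum>(b, c)\<in>fibre A (insert j J) a \<times> fibre A (- {j}) a. 1 / real (card (fibre A J a)))"
      by (intro sum.cong) auto
    then show "real (card (fibre A (insert j J) a)) * line_size A j a / card (fibre A J a)
       = (\<Sum>(b, c)\<in>fibre A (insert j J) a \<times> fibre A (- {j}) a. 1 / card (fibre A J c))"
      by (simp add: split_def card_cartesian_product)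
  qed
  also have "\<dots> = (\<Sum>(a, b, c)\<in>splices A J j. 1 / card (fibre A J c))"
    unfolding splices_def using assms(1) by (subst sum.Sigma) auto
  also have "\<dots> = (\<Sum>(c, b)\<in>(\<lambda>(a, b, c). (c, b)) ` splices A J j. 1 / card (fibre A J c))"
    by (subst sum.reindex [OF inj_on_splices]) (simp add: split_def)
  also have "\<dots> \<le> (\<Sum>(c, b)\<in>(SIGMA c:A. fibre A J c). 1 / card (fibre A J c))"
    using assms by (intro sum_mono2 splices_image) auto
  also have "\<dots> = (\<Sum>c\<in>A. \<Sum>b\<in>fibre A J c. 1 / card (fibre A J c))"
    using assms(1) by (subst sum.Sigma) auto
  also have "\<dots> = (\<Sum>c\<in>A. 1)"
  proof (rule sum.cong [OF refl])
    fix c assume "c \<in> A"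
    then show "(\<Sum>b\<in>fibre A J c. 1 / real (card (fibre A J c))) = 1"
      using card_fibre_pos [OF assms(1), of c J] by simp
  qed
  finally show ?thesis by simp
qed

text \<open>
  Conditioning reduces entropy: after division by \<open>card A\<close>, the left-hand side is the entropy of
  coordinate \<open>j\<close> given all other coordinates and the right-hand side is its entropy given the
  coordinates in \<open>J\<close> only. The difference of the two sides is the sum of \<open>ln q\<close> for the ratios \<open>q\<close>
  of the preceding lemma, and \<open>ln q \<le> q - 1\<close>.
\<close>

lemma sum_ln_line_size_le_step:
  assumes "finite A" "j \<notin> J"
  shows "(\<Sum>a\<in>A. ln (line_size A j a))
    \<le> (\<Sum>a\<in>A. ln (card (fibre A J a)) - ln (card (fibre A (insert j J) a)))"
proof -
  define q where "q a = real (card (fibre A (insert j J) a)) * line_size A j a / card (fibre A J a)"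
    for a
  have "(\<Sum>a\<in>A. ln (line_size A j a)
           - (ln (card (fibre A J a)) - ln (card (fibre A (insert j J) a)))) = (\<Sum>a\<in>A. ln (q a))"
  proof (rule sum.cong [OF refl])
    fix a assume "a \<in> A"
    note pos = card_fibre_pos [OF assms(1) this]
    show "ln (line_size A j a) - (ln (card (fibre A J a)) - ln (card (fibre A (insert j J) a)))
        = ln (q a)"
      using pos [of J] pos [of "insert j J"] pos [of "- {j}"]
      by (simp add: q_def ln_mult ln_div)
  qed
  also have "\<dots> \<le> (\<Sum>a\<in>A. q a - 1)"
  proof (rule sum_mono)
    fix a assume "a \<in> A"
    note pos = card_fibre_pos [OF assms(1) this]
    show "ln (q a) \<le> q a - 1"
      using pos [of J] pos [of "insert j J"] pos [of "- {j}"]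
      by (intro ln_le_minus_one) (simp add: q_def)
  qed
  also have "\<dots> \<le> 0"
    using sum_fibre_ratio_le [OF assms] by (simp add: q_def sum_subtractf)
  finally show ?thesis by (simp add: sum_subtractf)
qed

text \<open>The chain rule: the right-hand sides telescope as the elements of \<open>I\<close> are added to \<open>J\<close>.\<close>

lemma sum_ln_line_size_le:
  fixes I J :: "'n::finite set"
  assumes "finite A" "I \<inter> J = {}"
  shows "(\<Sum>a\<in>A. \<Sum>j\<in>I. ln (line_size A j a))
    \<le> (\<Sum>a\<in>A. ln (card (fibre A J a)) - ln (card (fibre A (I \<union> J) a)))"
  using finite [of I] assms(2)
proof (induction I)
  case empty
  then show ?case by simp
next
  case (insert j I)
  then have "j \<notin> I \<union> J" "I \<inter> J = {}" by auto
  with insert sum_ln_line_size_le_step [OF assms(1) this(1)] show ?case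
    by (simp add: sum.distrib sum_subtractf)
qed

text \<open>
  The chain rule with coordinate \<open>j\<close> revealed first, its own term being kept as it is. The
  resulting bound still involves the products of \<open>card (fibre A {j} a)\<close> and \<open>line_size A j a\<close>,
  which equality will force to be \<open>card A\<close>.
\<close>

lemma entropy_inequality_through:
  fixes A :: "(real ^ 'n) set"
  assumes "finite A"
  shows "(\<Sum>a\<in>A. \<Sum>j\<in>UNIV. ln (line_size A j a))
    \<le> (\<Sum>a\<in>A. ln (real (card (fibre A {j} a)) * line_size A j a))"
proof -
  have "(\<Sum>a\<in>A. \<Sum>k\<in>UNIV. ln (line_size A k a))
      = (\<Sum>a\<in>A. \<Sum>k\<in>- {j}. ln (line_size A k a)) + (\<Sum>a\<in>A. ln (line_size A j a))"
    by (simp add: sum.remove [of UNIV j] Compl_eq_Diff_UNIV sum.distrib)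
  also have "(\<Sum>a\<in>A. \<Sum>k\<in>- {j}. ln (line_size A k a))
      \<le> (\<Sum>a\<in>A. ln (card (fibre A {j} a)) - ln (card (fibre A UNIV a)))"
    using sum_ln_line_size_le [OF assms, of "- {j}" "{j}"] by (simp only: Compl_disjoint2 Compl_partition2)
  also have "\<dots> = (\<Sum>a\<in>A. ln (card (fibre A {j} a)))"
    by (intro sum.cong refl) (simp add: fibre_UNIV)
  also have "\<dots> + (\<Sum>a\<in>A. ln (line_size A j a))
      = (\<Sum>a\<in>A. ln (real (card (fibre A {j} a)) * line_size A j a))"
    unfolding sum.distrib [symmetric]
  proof (rule sum.cong [OF refl])
    fix a assume "a \<in> A"
    note pos = card_fibre_pos [OF assms this]
    show "ln (card (fibre A {j} a)) + ln (line_size A j a)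
        = ln (real (card (fibre A {j} a)) * line_size A j a)"
      using pos [of "{j}"] pos [of "- {j}"] by (simp add: ln_mult)
  qed
  finally show ?thesis by simp
qed

lemma entropy_inequality:
  fixes A :: "(real ^ 'n) set"
  assumes "finite A"
  shows "(\<Sum>a\<in>A. \<Sum>j\<in>UNIV. ln (line_size A j a)) \<le> card A * ln (card A)"
proof -
  have "(\<Sum>a\<in>A. \<Sum>j\<in>UNIV. ln (line_size A j a))
      \<le> (\<Sum>a\<in>A. ln (card (fibre A {} a)) - ln (card (fibre A (UNIV \<union> {}) a)))"
    by (rule sum_ln_line_size_le [OF assms]) auto
  also have "\<dots> = (\<Sum>a\<in>A. ln (card A))"
    by (intro sum.cong refl) (simp add: fibre_UNIV)
  finally show ?thesis by simp
qed

section \<open>Equality in the entropy inequality\<close>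

text \<open>
  Let \<open>q a\<close> be the ratio of \<open>sum_fibre_ratio_le\<close> for \<open>J = {}\<close>. Equality in the entropy
  inequality makes the sum of \<open>ln (q a)\<close> nonnegative, whereas the sum of \<open>q a - 1\<close> is at most
  \<open>0\<close>; so \<open>ln (q a) = q a - 1\<close> and \<open>q a = 1\<close> everywhere. Then there are as many splices as
  pairs \<open>(c, b)\<close>, and every pair occurs in a splice. The coordinate \<open>j\<close> is arbitrary, because any
  coordinate can be revealed first in the chain rule.
\<close>

lemma entropy_equality_exchange:
  fixes A :: "(real ^ 'n) set"
  assumes "finite A"
    and eq: "(\<Sum>a\<in>A. \<Sum>j\<in>UNIV. ln (line_size A j a)) = card A * ln (card A)"
    and "b \<in> A" "c \<in> A"
  shows "(\<chi> k. if k = j then b $ j else c $ k) \<in> A"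
proof -
  define m where "m = real (card A)"
  have m: "m > 0"
    using assms by (auto simp: m_def card_gt_0_iff)
  define q where "q a = real (card (fibre A {j} a)) * line_size A j a / m" for a
  have q: "q a > 0" if "a \<in> A" for a
    using card_fibre_pos [OF assms(1) that] m by (simp add: q_def)
  have ratio: "(\<Sum>a\<in>A. q a) \<le> m"
    using sum_fibre_ratio_le [OF assms(1), of j "{}"] by (simp add: q_def m_def)
  have "m * ln m \<le> (\<Sum>a\<in>A. ln (m * q a))"
    using entropy_inequality_through [OF assms(1), of j] eq m by (simp add: q_def m_def)
  also have "\<dots> = (\<Sum>a\<in>A. ln m + ln (q a))"
    using q m by (intro sum.cong refl) (simp add: ln_mult less_imp_neq [THEN not_sym])
  finally have "0 \<le> (\<Sum>a\<in>A. ln (q a))"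
    by (simp add: sum.distrib m_def)
  with ratio have "(\<Sum>a\<in>A. (q a - 1) - ln (q a)) \<le> 0"
    by (simp add: sum_subtractf m_def)
  moreover have nonneg: "0 \<le> (q a - 1) - ln (q a)" if "a \<in> A" for a
    using ln_le_minus_one [OF q [OF that]] by simp
  ultimately have "(\<Sum>a\<in>A. (q a - 1) - ln (q a)) = 0"
    by (intro antisym sum_nonneg)
  then have "(q a - 1) - ln (q a) = 0" if "a \<in> A" for a
    using sum_nonneg_eq_0_iff [OF assms(1) nonneg] that by auto
  then have "q a = 1" if "a \<in> A" for a
    using ln_eq_minus_one [OF q [OF that]] that by force
  then have "real (card (fibre A {j} a)) * line_size A j a = m" if "a \<in> A" for a
    using that m by (force simp: q_def field_simps)
  then have "card (fibre A {j} a) * line_size A j a = card A" if "a \<in> A" for a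
    using that unfolding m_def by (metis of_nat_eq_iff of_nat_mult)
  then have "card (splices A {} j) = card (A \<times> A)"
    using assms(1) by (simp add: splices_def card_SigmaI card_cartesian_product)
  then have "card ((\<lambda>(a, b, c). (c, b)) ` splices A {} j) = card (A \<times> A)"
    by (simp add: card_image [OF inj_on_splices])
  moreover have "(\<lambda>(a, b, c). (c, b)) ` splices A {} j \<subseteq> A \<times> A"
    using splices_image [of j "{}" A] by simp
  ultimately have "(\<lambda>(a, b, c). (c, b)) ` splices A {} j = A \<times> A"
    using assms(1) by (metis card_subset_eq finite_cartesian_product)
  then have "(c, b) \<in> (\<lambda>(a, b, c). (c, b)) ` splices A {} j"
    using assms(3,4) by simp
  then obtain a where "a \<in> A" "b \<in> fibre A {j} a" "c \<in> fibre A (- {j}) a"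
    by (auto simp: splices_def)
  moreover from this have "a = (\<chi> k. if k = j then b $ j else c $ k)"
    by (auto simp: fibre_def vec_eq_iff)
  ultimately show ?thesis by simp
qed

lemma cart_prod_if_exchange:
  fixes A :: "(real ^ 'n) set"
  assumes "A \<noteq> {}"
    and exch: "\<And>b c j. b \<in> A \<Longrightarrow> c \<in> A \<Longrightarrow> (\<chi> k. if k = j then b $ j else c $ k) \<in> A"
  shows "A = cart_prod (\<lambda>j. (\<lambda>a. a $ j) ` A)"
proof
  show "A \<subseteq> cart_prod (\<lambda>j. (\<lambda>a. a $ j) ` A)"
    by (auto simp: cart_prod_def)
  show "cart_prod (\<lambda>j. (\<lambda>a. a $ j) ` A) \<subseteq> A"
  proof
    fix x assume x: "x \<in> cart_prod (\<lambda>j. (\<lambda>a. a $ j) ` A)"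
    \<comment> \<open>Correct the coordinates of a point of \<open>A\<close> one after the other until it becomes \<open>x\<close>.\<close>
    have "\<exists>a\<in>A. \<forall>k\<in>J. a $ k = x $ k" for J :: "'n set"
      using finite [of J]
    proof (induction J)
      case empty
      then show ?case using assms(1) by auto
    next
      case (insert j J)
      then obtain c where "c \<in> A" "\<forall>k\<in>J. c $ k = x $ k" by blast
      moreover have "x $ j \<in> (\<lambda>a. a $ j) ` A"
        using x by (simp add: cart_prod_def)
      then obtain b where "b \<in> A" "b $ j = x $ j" by auto
      ultimately show ?case
        using exch [of b c j]
        by (intro bexI [of _ "\<chi> k. if k = j then b $ j else c $ k"]) auto
    qed
    from this [of UNIV] show "x \<in> A"
      by (metis UNIV_I vec_eq_iff)
  qed
qed

section \<open>Boxes\<close>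

lemma bij_betw_cart_prod: "bij_betw vec_nth (cart_prod S) (PiE UNIV S)"
  by (rule bij_betw_byWitness [where f' = "\<lambda>f. vec_lambda f"])
     (auto simp: cart_prod_def PiE_def Pi_def)

lemma finite_cart_prod: "(\<And>j. finite (S j)) \<Longrightarrow> finite (cart_prod S)"
  using bij_betw_finite [OF bij_betw_cart_prod, of S] by (simp add: finite_PiE)

lemma card_cart_prod: "card (cart_prod S) = (\<Prod>j\<in>UNIV. card (S j))"
  using bij_betw_same_card [OF bij_betw_cart_prod, of S] by (simp add: card_PiE)

lemma line_size_cart_prod:
  assumes "a \<in> cart_prod S"
  shows "line_size (cart_prod S) j a = card (S j)"
proof (rule bij_betw_same_card)
  show "bij_betw (\<lambda>b. b $ j) (fibre (cart_prod S) (- {j}) a) (S j)"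
    by (rule bij_betw_byWitness [where f' = "\<lambda>t. \<chi> k. if k = j then t else a $ k"])
       (use assms in \<open>auto simp: fibre_def cart_prod_def vec_eq_iff split: if_splits\<close>)
qed

lemma prod_two_sizes:
  fixes s :: "'n::finite \<Rightarrow> nat"
  assumes "\<And>j. s j = K \<or> s j = K + 1"
  shows "(\<Prod>j\<in>UNIV. s j) = (K + 1) ^ card {j. s j = K + 1} * K ^ (CARD('n) - card {j. s j = K + 1})"
proof -
  define I where "I = {j. s j = K + 1}"
  have "(\<Prod>j\<in>UNIV. s j) = (\<Prod>j\<in>I. s j) * (\<Prod>j\<in>- I. s j)"
    by (subst prod.union_disjoint [symmetric]) auto
  also have "(\<Prod>j\<in>I. s j) = (\<Prod>j\<in>I. K + 1)"
    by (rule prod.cong) (auto simp: I_def)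
  also have "(\<Prod>j\<in>- I. s j) = (\<Prod>j\<in>- I. K)"
    using assms by (intro prod.cong) (auto simp: I_def)
  finally show ?thesis
    by (simp add: I_def Compl_eq_Diff_UNIV card_Diff_subset)
qed

section \<open>The chord inequality\<close>

text \<open>
  This is the ratio \<open>(ln (K + 1) - ln K) / (1 / K - 1 / (K + 1))\<close>, that is, minus the slope of
  the chord of \<open>ln s\<close> against \<open>1 / s\<close> between \<open>K\<close> and \<open>K + 1\<close>.
\<close>

definition chord_slope :: "nat \<Rightarrow> real" where
  "chord_slope K = real K * (real K + 1) * ln (1 + 1 / K)"

lemma chord_slope_pos: "K \<ge> 1 \<Longrightarrow> chord_slope K > 0"
  unfolding chord_slope_def by (intro mult_pos_pos ln_gt_zero) auto

text \<open>
  Monotonicity of the slopes is the discrete form of convexity. It holds because \<open>s + 1\<close>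
  separates the two values, by \<open>ln (1 + t) < t\<close> at \<open>t = 1 / s\<close> and \<open>t / (1 + t) < ln (1 + t)\<close> at
  \<open>t = 1 / (s + 1)\<close>.
\<close>

lemma chord_slope_Suc:
  assumes "s \<ge> 1"
  shows "chord_slope s < chord_slope (Suc s)"
proof -
  define x where "x = real s"
  have x: "x > 0" using assms by (simp add: x_def)
  have "chord_slope s < x * (x + 1) * (1 / x)"
    unfolding chord_slope_def x_def [symmetric]
    using x by (intro mult_strict_left_mono ln_add_one_self_less_self) auto
  also have "\<dots> = (x + 1) * (x + 2) * (1 / (x + 2))"
    using x by simp
  also have "\<dots> < (x + 1) * (x + 2) * ln (1 + 1 / (x + 1))"
  proof (rule mult_strict_left_mono)
    have "1 / (x + 2) = 1 / (x + 1) / (1 + 1 / (x + 1))"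
      using x by (simp add: field_simps)
    also have "\<dots> < ln (1 / (x + 1) + 1)"
      using x by (intro ln_add1_gt) auto
    finally show "1 / (x + 2) < ln (1 + 1 / (x + 1))"
      by (simp add: add.commute)
  qed (use x in auto)
  also have "\<dots> = chord_slope (Suc s)"
    by (simp add: chord_slope_def x_def add_ac)
  finally show ?thesis .
qed

lemma chord_slope_less:
  assumes "1 \<le> s" "s < t"
  shows "chord_slope s < chord_slope t"
  using assms(2,1)
  by (induction rule: less_Suc_induct) (auto intro: chord_slope_Suc)

text \<open>
  Adding \<open>ln s\<close> to this multiple of \<open>1 / s\<close> makes the chord between \<open>K\<close> and \<open>K + 1\<close> horizontal,
  so that lying above the chord becomes having a minimum at its two ends.
\<close>

definition tilted_inverse :: "nat \<Rightarrow> nat \<Rightarrow> real" where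
  "tilted_inverse K s = chord_slope K / s + ln s"

lemma tilted_inverse_Suc:
  assumes "s \<ge> 1"
  shows "tilted_inverse K (Suc s) - tilted_inverse K s
    = (chord_slope s - chord_slope K) / (real s * (real s + 1))"
proof -
  define x where "x = real s"
  have x: "x > 0" using assms by (simp add: x_def)
  have "ln (1 + 1 / x) = ln ((x + 1) / x)"
    using x by (simp add: field_simps)
  also have "\<dots> = ln (x + 1) - ln x"
    using x by (simp add: ln_div)
  finally have "chord_slope s / (x * (x + 1)) = ln (x + 1) - ln x"
    using x by (simp add: chord_slope_def x_def [symmetric])
  moreover have "chord_slope K / x - chord_slope K / (x + 1) = chord_slope K / (x * (x + 1))"
    using x by (simp add: field_simps)
  ultimately show ?thesis
    by (simp add: tilted_inverse_def x_def [symmetric] diff_divide_distrib add.commute)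
qed

lemma tilted_inverse_chord_ends: "K \<ge> 1 \<Longrightarrow> tilted_inverse K (K + 1) = tilted_inverse K K"
  using tilted_inverse_Suc [of K K] by simp

text \<open>
  By \<open>tilted_inverse_Suc\<close> and the monotonicity of the slopes, the increments are negative before
  \<open>K\<close>, zero from \<open>K\<close> to \<open>K + 1\<close>, and positive afterwards.
\<close>

lemma tilted_inverse_gt:
  assumes "K \<ge> 1" "s \<ge> 1" "s \<noteq> K" "s \<noteq> K + 1"
  shows "tilted_inverse K K < tilted_inverse K s"
proof -
  have down: "tilted_inverse K (Suc t) < tilted_inverse K t" if "1 \<le> t" "t < K" for t
  proof -
    have "(chord_slope t - chord_slope K) / (real t * (real t + 1)) < 0"
      using chord_slope_less [OF that] that by (intro divide_neg_pos) auto
    then show ?thesis using tilted_inverse_Suc [OF that(1), of K] by simp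
  qed
  have up: "tilted_inverse K t < tilted_inverse K (Suc t)" if "K < t" for t
  proof -
    have "(chord_slope t - chord_slope K) / (real t * (real t + 1)) > 0"
      using chord_slope_less [OF assms(1) that] that by (intro divide_pos_pos) auto
    then show ?thesis using tilted_inverse_Suc [of t K] that by simp
  qed
  consider "s < K" | "Suc (Suc K) \<le> s" using assms(3,4) by linarith
  then show ?thesis
  proof cases
    case 1
    then show ?thesis using assms(2)
    proof (induction rule: strict_inc_induct)
      case (base t)
      then show ?case using down [of t] by simp
    next
      case (step t)
      then show ?case using down [of t] by simp
    qed
  next
    case 2
    then show ?thesis
    proof (induction rule: dec_induct)
      case base
      then show ?case
        using up [of "Suc K"] tilted_inverse_chord_ends [OF assms(1)] by simp
    next
      case (step t)
      then show ?case using up [of t] by simp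
    qed
  qed
qed

lemma tilted_inverse_ge:
  assumes "K \<ge> 1" "s \<ge> 1"
  shows "tilted_inverse K K \<le> tilted_inverse K s"
  using tilted_inverse_gt [OF assms] tilted_inverse_chord_ends [OF assms(1)]
  by (cases "s = K \<or> s = K + 1") auto

section \<open>Minimisers\<close>

lemma chord_slope_proj_sum:
  fixes A :: "(real ^ 'n) set"
  assumes "finite A"
  shows "chord_slope K * proj_sum A
    = (\<Sum>a\<in>A. \<Sum>j\<in>UNIV. tilted_inverse K (line_size A j a))
      - (\<Sum>a\<in>A. \<Sum>j\<in>UNIV. ln (line_size A j a))"
  unfolding proj_sum_eq [OF assms] tilted_inverse_def
  by (subst sum.swap) (simp add: sum.distrib sum_distrib_left)

text \<open>
  The right-hand side is a lower bound for every finite set of the same size, by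
  \<open>tilted_inverse_ge\<close> and \<open>entropy_inequality\<close>; a box with sides of size \<open>K\<close> and \<open>K + 1\<close> has
  equality in both.
\<close>

lemma chord_slope_proj_sum_box:
  fixes S :: "'n::finite \<Rightarrow> real set"
  assumes "K \<ge> 1" and S: "\<And>j. finite (S j)" "\<And>j. card (S j) = K \<or> card (S j) = K + 1"
  shows "chord_slope K * proj_sum (cart_prod S)
    = real (card (cart_prod S)) * (CARD('n) * tilted_inverse K K - ln (card (cart_prod S)))"
proof -
  let ?B = "cart_prod S"
  have "(\<Sum>a\<in>?B. \<Sum>j\<in>UNIV. tilted_inverse K (line_size ?B j a))
      = (\<Sum>a\<in>?B. \<Sum>j\<in>(UNIV :: 'n set). tilted_inverse K K)"
  proof (intro sum.cong refl)
    fix a j assume "a \<in> ?B"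
    then show "tilted_inverse K (line_size ?B j a) = tilted_inverse K K"
      using S(2) [of j] tilted_inverse_chord_ends [OF assms(1)]
      by (auto simp: line_size_cart_prod)
  qed
  moreover have "(\<Sum>a\<in>?B. \<Sum>j\<in>UNIV. ln (line_size ?B j a)) = (\<Sum>a\<in>?B. ln (card ?B))"
  proof (rule sum.cong [OF refl])
    fix a assume a: "a \<in> ?B"
    have "card (S j) > 0" for j
      using S(2) [of j] assms(1) by auto
    then have "(\<Sum>j\<in>UNIV. ln (real (card (S j)))) = ln (card ?B)"
      by (simp add: card_cart_prod ln_prod)
    then show "(\<Sum>j\<in>UNIV. ln (line_size ?B j a)) = ln (card ?B)"
      by (simp add: line_size_cart_prod [OF a])
  qed
  ultimately show ?thesis
    unfolding chord_slope_proj_sum [OF finite_cart_prod [OF S(1)]]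
    by (simp add: algebra_simps)
qed

text \<open>
  The excess of \<open>chord_slope K * proj_sum A\<close> over the bound is a sum of two nonnegative parts:
  what the line sizes lose against \<open>tilted_inverse K K\<close>, and the defect of the entropy
  inequality. If there is no excess, both parts vanish.
\<close>

lemma proj_sum_extremal:
  fixes A :: "(real ^ 'n) set"
  assumes "finite A" "K \<ge> 1"
    and le: "chord_slope K * proj_sum A \<le> card A * (CARD('n) * tilted_inverse K K - ln (card A))"
  shows "(\<Sum>a\<in>A. \<Sum>j\<in>UNIV. ln (line_size A j a)) = card A * ln (card A)"
    and "\<And>a j. a \<in> A \<Longrightarrow> line_size A j a = K \<or> line_size A j a = K + 1"
proof -
  let ?excess = "\<lambda>a j. tilted_inverse K (line_size A j a) - tilted_inverse K K"
  let ?E = "\<Sum>a\<in>A. \<Sum>j\<in>UNIV. ?excess a j"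
  have pos: "1 \<le> line_size A j a" if "a \<in> A" for a j
    using card_fibre_pos [OF assms(1) that, of "- {j}"] by simp
  then have nonneg: "0 \<le> ?excess a j" if "a \<in> A" for a j
    using tilted_inverse_ge [OF assms(2) pos [OF that]] by simp
  have ent: "(\<Sum>a\<in>A. \<Sum>j\<in>UNIV. ln (line_size A j a)) \<le> card A * ln (card A)"
    by (rule entropy_inequality [OF assms(1)])
  have le': "?E + (card A * ln (card A) - (\<Sum>a\<in>A. \<Sum>j\<in>UNIV. ln (line_size A j a))) \<le> 0"
    using le unfolding chord_slope_proj_sum [OF assms(1)]
    by (simp add: sum_subtractf algebra_simps)
  have "0 \<le> ?E"
    by (intro sum_nonneg nonneg)
  with le' ent show "(\<Sum>a\<in>A. \<Sum>j\<in>UNIV. ln (line_size A j a)) = card A * ln (card A)"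
    by linarith
  have "?E = 0"
    using le' ent \<open>0 \<le> ?E\<close> by linarith
  fix a j assume a: "a \<in> A"
  have "(\<Sum>j\<in>UNIV. ?excess a j) = 0"
    using \<open>?E = 0\<close> a
    by (subst (asm) sum_nonneg_eq_0_iff) (auto intro: assms(1) sum_nonneg nonneg)
  then have "?excess a j = 0"
    by (subst (asm) sum_nonneg_eq_0_iff) (use nonneg [OF a] in auto)
  then show "line_size A j a = K \<or> line_size A j a = K + 1"
    using tilted_inverse_gt [OF assms(2) pos [OF a]] by fastforce
qed

lemma exists_box:
  assumes "i \<le> CARD('n)"
  obtains S :: "'n::finite \<Rightarrow> real set"
  where "\<And>j. finite (S j)" "\<And>j. card (S j) = K \<or> card (S j) = K + 1"
    "card (cart_prod S) = (K + 1) ^ i * K ^ (CARD('n) - i)"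
proof -
  obtain I :: "'n set" where I: "card I = i"
    using obtain_subset_with_card_n [OF assms] by metis
  define S where "S j = real ` {..<if j \<in> I then K + 1 else K}" for j
  have card_S: "card (S j) = (if j \<in> I then K + 1 else K)" for j
    by (simp add: S_def card_image)
  then have "{j. card (S j) = K + 1} = I" by auto
  then have "card (cart_prod S) = (K + 1) ^ i * K ^ (CARD('n) - i)"
    using prod_two_sizes [of "\<lambda>j. card (S j)" K] card_S I by (simp add: card_cart_prod)
  then show ?thesis
    using that [of S] card_S by (simp add: S_def)
qed

lemma two_sizes_exponent_unique:
  fixes K p i n :: nat
  assumes "(K + 1) ^ p * K ^ (n - p) = (K + 1) ^ i * K ^ (n - i)"
    and "K \<ge> 1" "p \<le> n" "i \<le> n"
  shows "p = i"
proof -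
  have less: "(K + 1) ^ p * K ^ (n - p) < (K + 1) ^ q * K ^ (n - q)"
    if "p < q" "q \<le> n" for p q
  proof -
    have "(K + 1) ^ p * K ^ (n - p) = (K + 1) ^ p * K ^ (q - p) * K ^ (n - q)"
      using that by (simp only: mult.assoc power_add [symmetric]) simp
    also have "\<dots> < (K + 1) ^ p * (K + 1) ^ (q - p) * K ^ (n - q)"
      using that assms(2) by (simp add: power_strict_mono)
    also have "\<dots> = (K + 1) ^ q * K ^ (n - q)"
      using that by (simp only: power_add [symmetric]) simp
    finally show ?thesis .
  qed
  show ?thesis
    using less [of p i] less [of i p] assms by (cases p i rule: linorder_cases) auto
qed

theorem theorem2:
  fixes A :: "(real ^ 'n) set" and K i :: nat
  assumes "K \<ge> 1"
    and "i \<le> CARD('n) - 1"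
    and "minimiser A"
    and "card A = (K + 1) ^ i * K ^ (CARD('n) - i)"
  shows "\<exists>S :: 'n \<Rightarrow> real set.
           A = cart_prod S \<and>
           (\<forall>j. finite (S j)) \<and>
           card {j. card (S j) = K + 1} = i \<and>
           card {j. card (S j) = K} = CARD('n) - i"
proof -
  have fin: "finite A"
    using assms(3) by (simp add: minimiser_def)
  have "A \<noteq> {}"
    using assms(1,4) by auto
  have i: "i \<le> CARD('n)"
    using assms(2) by simp
  obtain T :: "'n \<Rightarrow> real set"
    where T: "\<And>j. finite (T j)" "\<And>j. card (T j) = K \<or> card (T j) = K + 1"
      and card_T: "card (cart_prod T) = card A"
    using exists_box [OF i, of K] assms(4) by metis
  have "proj_sum A \<le> proj_sum (cart_prod T)"
    using assms(3) card_T finite_cart_prod [of T] T(1) unfolding minimiser_def by blast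
  then have "chord_slope K * proj_sum A \<le> chord_slope K * proj_sum (cart_prod T)"
    using chord_slope_pos [OF assms(1)] by simp
  also have "\<dots> = card A * (CARD('n) * tilted_inverse K K - ln (card A))"
    using chord_slope_proj_sum_box [of K T] assms(1) T card_T by simp
  finally have bound: "chord_slope K * proj_sum A
      \<le> card A * (CARD('n) * tilted_inverse K K - ln (card A))" .
  note extremal = proj_sum_extremal [OF fin assms(1) bound]
  define S where "S j = (\<lambda>a. a $ j) ` A" for j
  have A: "A = cart_prod S"
    unfolding S_def
    using \<open>A \<noteq> {}\<close> entropy_equality_exchange [OF fin extremal(1)] by (rule cart_prod_if_exchange)
  have sizes: "card (S j) = K \<or> card (S j) = K + 1" for j
    using \<open>A \<noteq> {}\<close> extremal(2) line_size_cart_prod [of _ S j] A by (metis ex_in_conv)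
  let ?I = "{j. card (S j) = K + 1}"
  have "(K + 1) ^ card ?I * K ^ (CARD('n) - card ?I) = (K + 1) ^ i * K ^ (CARD('n) - i)"
    using prod_two_sizes [of "\<lambda>j. card (S j)" K] sizes assms(4) A card_cart_prod [of S] by simp
  then have card_I: "card ?I = i"
    by (rule two_sizes_exponent_unique) (use assms(1) i in \<open>simp_all add: card_mono\<close>)
  have "{j. card (S j) = K} = - ?I"
    using sizes by auto
  then have "card {j. card (S j) = K} = CARD('n) - i"
    using card_I by (simp add: Compl_eq_Diff_UNIV card_Diff_subset)
  then show ?thesis
    using A card_I fin by (intro exI [of _ S]) (auto simp: S_def)
qed

end
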